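(* If $r$ is a positive integer, then $$[q^{2r}]\sum_{n=1}^\infty\sum_{m=1}^\infty\frac{q^{2mn}}{(1+q^{2n-1})(1-q^{2m-1})}=[q^{2r}]\sum_{n=1}^\infty\frac{(n-1)q^n}{1+q^{2n-1}}.$$
   Context: For a power series $F(q)=\sum_{j\ge 0}f_j q^j$, $[q^{j}]F(q)$ denotes the coefficient $f_j$ of $q^j$. Each series above is regarded as a power series in $q$ (expanding each rational function around $q=0$), equivalently as the Taylor expansion at $0$ of a function analytic in $|q|<1$. *)

theory Defs
  imports
    "HOL-Analysis.Infinite_Sum"
    "HOL-Computational_Algebra.Formal_Power_Series"
begin

text \<open>
  Infinite sums of formal power series are unordered sums (\<^const>\<open>infsum\<close>) with respect to the
  q-adic metric on \<^typ>\<open>complex fps\<close>. As \<^const>\<open>infsum\<close> takes the value 0 on families that are not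
  summable, the facts below record that all sums in question do converge, and that their
  coefficients are the expected finite sums of coefficients.
\<close>

lemma fps_has_sum_locally_finite:
  fixes f :: "'i \<Rightarrow> complex fps"
  assumes fin: "\<And>k. finite {i \<in> A. fps_nth (f i) k \<noteq> 0}"
  shows "(f has_sum Abs_fps (\<lambda>k. \<Sum>i | i \<in> A \<and> fps_nth (f i) k \<noteq> 0. fps_nth (f i) k)) A"
    (is "(f has_sum ?S) A")
  unfolding has_sum_def tendsto_iff
proof (intro allI impI)
  fix e :: real assume "e > 0"
  then obtain N :: nat where N: "inverse (2 ^ N) < e"
    using real_arch_pow_inv[of e "1/2"] by (auto simp: power_one_over inverse_eq_divide)
  define B where "B = (\<Union>k\<le>N. {i \<in> A. fps_nth (f i) k \<noteq> 0})"
  have B: "finite B" "B \<subseteq> A"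
    using fin by (auto simp: B_def)
  have "dist (sum f F) ?S < e" if F: "finite F" "B \<subseteq> F" "F \<subseteq> A" for F
  proof (cases "sum f F = ?S")
    case True
    then show ?thesis using \<open>e > 0\<close> by simp
  next
    case False
    have "fps_nth (sum f F) k = fps_nth ?S k" if "k \<le> N" for k
    proof -
      have "fps_nth (sum f F) k = (\<Sum>i\<in>F. fps_nth (f i) k)"
        by (simp add: fps_sum_nth)
      also have "\<dots> = (\<Sum>i | i \<in> A \<and> fps_nth (f i) k \<noteq> 0. fps_nth (f i) k)"
        using F that by (intro sum.mono_neutral_right) (auto simp: B_def)
      finally show ?thesis by simp
    qed
    then have "subdegree (sum f F - ?S) > N"
      using False by (intro subdegree_greaterI) auto
    then have "inverse (2 ^ subdegree (sum f F - ?S)) \<le> inverse (2 ^ N :: real)"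
      by (intro le_imp_inverse_le power_increasing) auto
    then show ?thesis
      unfolding dist_fps_def using False N by (simp only: if_False)
  qed
  then show "\<forall>\<^sub>F F in finite_subsets_at_top A. dist (sum f F) ?S < e"
    using B by (auto simp: eventually_finite_subsets_at_top)
qed

lemma fps_summable_locally_finite:
  fixes f :: "'i \<Rightarrow> complex fps"
  assumes "\<And>k. finite {i \<in> A. fps_nth (f i) k \<noteq> 0}"
  shows "f summable_on A"
    and "fps_nth (infsum f A) k = (\<Sum>i | i \<in> A \<and> fps_nth (f i) k \<noteq> 0. fps_nth (f i) k)"
  using fps_has_sum_locally_finite[OF assms]
  by (auto simp: summable_on_def dest: infsumI)

lemma finite_coeffs_by_order:
  fixes f :: "nat \<Rightarrow> complex fps"
  assumes "\<And>i k. i \<in> A \<Longrightarrow> k < i \<Longrightarrow> fps_nth (f i) k = 0"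
  shows "finite {i \<in> A. fps_nth (f i) k \<noteq> 0}"
  by (rule finite_subset[of _ "{..k}"]) (use assms not_le in auto)

lemma fps_X_power_divide:
  fixes g :: "complex fps"
  assumes "fps_nth g 0 \<noteq> 0"
  shows "h * fps_X ^ a / g = fps_X ^ a * (h * inverse g)"
  using assms by (simp add: fps_divide_unit mult_ac)

abbreviation (input) lhs_term :: "nat \<Rightarrow> nat \<Rightarrow> complex fps" where
  "lhs_term n m \<equiv> fps_X ^ (2 * m * n) / ((1 + fps_X ^ (2 * n - 1)) * (1 - fps_X ^ (2 * m - 1)))"

abbreviation (input) rhs_term :: "nat \<Rightarrow> complex fps" where
  "rhs_term n \<equiv> of_nat (n - 1) * fps_X ^ n / (1 + fps_X ^ (2 * n - 1))"

lemma lhs_term_nth_eq_0: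
  assumes "n \<ge> 1" "m \<ge> 1" "k < 2 * m * n"
  shows "fps_nth (lhs_term n m) k = 0"
  using assms fps_X_power_divide[of "(1 + fps_X ^ (2 * n - 1)) * (1 - fps_X ^ (2 * m - 1))" 1 "2 * m * n"]
  by (simp add: fps_X_power_mult_nth)

lemma rhs_term_nth_eq_0:
  assumes "n \<ge> 1" "k < n"
  shows "fps_nth (rhs_term n) k = 0"
  using assms fps_X_power_divide[of "1 + fps_X ^ (2 * n - 1)" "of_nat (n - 1)" n]
  by (simp add: fps_X_power_mult_nth)

lemma summable_lhs_inner:
  assumes "n \<ge> 1"
  shows "lhs_term n summable_on {1..}"
proof (intro fps_summable_locally_finite finite_coeffs_by_order)
  fix m k :: nat assume "m \<in> {1..}" "k < m"
  moreover from assms have "m * 1 \<le> 2 * m * n" by (intro mult_le_mono) auto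
  ultimately have "k < 2 * m * n" by linarith
  with assms \<open>m \<in> {1..}\<close> show "fps_nth (lhs_term n m) k = 0"
    by (intro lhs_term_nth_eq_0) simp_all
qed

lemma summable_lhs_outer: "(\<lambda>n. \<Sum>\<^sub>\<infinity>m\<in>{1..}. lhs_term n m) summable_on {1..}"
proof (intro fps_summable_locally_finite finite_coeffs_by_order)
  fix n k :: nat assume nk: "n \<in> {1..}" "k < n"
  have *: "fps_nth (lhs_term n m) j = 0" if "m \<in> {1..}" "j < m \<or> j < n" for m j
  proof -
    have "m * 1 \<le> 2 * m * n" "1 * n \<le> 2 * m * n"
      using that nk by (intro mult_le_mono; simp)+
    then have "j < 2 * m * n" using that by linarith
    then show ?thesis using that nk by (intro lhs_term_nth_eq_0) simp_all
  qed
  have "fps_nth (infsum (lhs_term n) {1..}) k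
      = (\<Sum>m | m \<in> {1..} \<and> fps_nth (lhs_term n m) k \<noteq> 0. fps_nth (lhs_term n m) k)"
    by (intro fps_summable_locally_finite finite_coeffs_by_order) (use * in auto)
  also have "\<dots> = 0"
    using * nk by (intro sum.neutral) auto
  finally show "fps_nth (\<Sum>\<^sub>\<infinity>m\<in>{1..}. lhs_term n m) k = 0" .
qed

lemma summable_rhs: "rhs_term summable_on {1..}"
  by (intro fps_summable_locally_finite finite_coeffs_by_order) (rule rhs_term_nth_eq_0, simp_all)

end

theory Submission
  imports Defs
begin

text \<open>
  Put \<open>N = 4r - 1\<close> and let \<open>\<chi>\<close> be the nontrivial character modulo 4. Expanding the geometric series
  and writing \<open>x = 2n - 1\<close>, \<open>y = 2m - 1\<close>, the coefficient of the double series becomes the sum of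
  \<open>\<chi>(u)\<close> over all odd positive \<open>x, y, u, v\<close> with \<open>xy + xu + yv = N\<close>. The coefficient of the single
  series becomes the sum of \<open>(d - 1)/2 \<cdot> \<chi>(e)\<close> over all factorisations \<open>N = de\<close>.

  Both are sums over quadruples of positive integers with \<open>ad + bc = N\<close>, the set \<open>quads N\<close>: the first
  through \<open>(a, b, c, d) = (v, y + u, x, y)\<close>, where \<open>b > d\<close> and \<open>u = b - d\<close>; the second
  through the quadruples \<open>(a, e, c, e)\<close> with \<open>a\<close> even, where the factorisation is \<open>N = (a + c) e\<close> and
  \<open>a\<close> takes \<open>(a + c - 1)/2\<close> values. On \<open>quads N\<close> there is a subtractive Euclidean step, which sends
  \<open>(a, b, c, d)\<close> to \<open>(a + c, b - d, c, d)\<close> if \<open>b > d\<close> and to \<open>(a, b, a + c, d - b)\<close> if \<open>b < d\<close>.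
  It is a bijection from the quadruples with \<open>b \<noteq> d\<close> onto those with \<open>a \<noteq> c\<close>. Hence for any function \<open>g\<close> the
  sum of all increments of \<open>g\<close> along the step collapses to the sum of \<open>g\<close> over \<open>b = d\<close> minus the sum
  over \<open>a = c\<close> (lemma \<open>sum_quads_step\<close>).

  The proof applies this to one function \<open>weight\<close>, supported on even \<open>a\<close>. As \<open>N\<close> is odd, \<open>a = c\<close> forces
  \<open>a\<close> to be odd, so that the boundary terms are twice the divisor sum. A quarter turn carries the
  increments with \<open>b < d\<close> to the region \<open>b > d\<close>, where the total increment is, quadruple by quadruple,
  twice the summand of the double series up to a term that an involution cancels (lemmas
  \<open>weight_increments\<close> and \<open>sum_chi_antisymmetric\<close>). All signs come from one observation: if
  \<open>xy \<equiv> 3 (mod 4)\<close>, then \<open>\<chi>(x) = -\<chi>(y)\<close>.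

  Geometrically, a quadruple is a basis \<open>(a, b), (c, -d)\<close> of a sublattice of index \<open>N\<close> in the integer
  plane with one vector in the first and one in the fourth quadrant, and the step replaces one of the
  two vectors by their sum. The bases of this kind thus form finite chains, and the sum of the
  increments over a chain telescopes.
\<close>

section \<open>Coefficients of the two series\<close>

lemma inverse_one_minus_const_X_power_nth:
  fixes c :: complex
  assumes "x > 0"
  shows "fps_nth (inverse (1 - fps_const c * fps_X ^ x)) k = (if x dvd k then c ^ (k div x) else 0)"
proof -
  define E where "E = Abs_fps (\<lambda>k. if x dvd k then c ^ (k div x) else 0)"
  have "fps_nth (E * (1 - fps_const c * fps_X ^ x)) k = fps_nth 1 k" for k
  proof (cases "k < x")
    case True
    then have "x dvd k \<longleftrightarrow> k = 0" using assms by (auto dest: dvd_imp_le)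
    then show ?thesis using True
      by (auto simp: E_def algebra_simps fps_X_power_mult_nth)
  next
    case False
    then obtain j where k: "k = x + j" using le_Suc_ex not_less by blast
    have "(x + j) div x = Suc (j div x)" using assms by simp
    then show ?thesis using assms
      by (simp add: E_def k algebra_simps fps_X_power_mult_nth)
  qed
  then have "E * (1 - fps_const c * fps_X ^ x) = 1" by (simp add: fps_eq_iff)
  then have "inverse (1 - fps_const c * fps_X ^ x) = E"
    by (intro fps_inverse_unique) (simp add: mult.commute)
  then show ?thesis by (simp add: E_def)
qed

lemma inverse_one_plus_X_power_nth:
  assumes "x > 0"
  shows "fps_nth (inverse (1 + fps_X ^ x) :: complex fps) k = (if x dvd k then (- 1) ^ (k div x) else 0)"
proof -
  have "1 + fps_X ^ x = (1 - fps_const (- 1) * fps_X ^ x :: complex fps)"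
    by (simp flip: fps_const_neg)
  then show ?thesis by (simp only: inverse_one_minus_const_X_power_nth[OF assms])
qed

lemma inverse_one_minus_X_power_nth:
  assumes "x > 0"
  shows "fps_nth (inverse (1 - fps_X ^ x) :: complex fps) k = (if x dvd k then 1 else 0)"
  using inverse_one_minus_const_X_power_nth[OF assms, of 1 k] by simp

lemma rhs_term_nth:
  assumes "n \<ge> 1"
  shows "fps_nth (rhs_term n) t = of_nat (n - 1) * (\<Sum>k | n + k * (2 * n - 1) = t. (- 1) ^ k)"
proof -
  define x where "x = 2 * n - 1"
  have x: "x > 0" using assms by (simp add: x_def)
  have "rhs_term n = fps_X ^ n * (of_nat (n - 1) * inverse (1 + fps_X ^ x))"
    unfolding x_def by (rule fps_X_power_divide) (use assms in simp)
  then have coeff: "fps_nth (rhs_term n) t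
      = (if t < n then 0 else of_nat (n - 1) * (if x dvd t - n then (- 1) ^ ((t - n) div x) else 0))"
    using x by (simp add: fps_X_power_mult_nth inverse_one_plus_X_power_nth
        flip: fps_of_nat)
  have "{k. n + k * x = t} = (if n \<le> t \<and> x dvd t - n then {(t - n) div x} else {})"
    using x by (auto simp: dvd_def mult.commute)
  then show ?thesis unfolding coeff unfolding x_def[symmetric] by auto
qed

lemma lhs_term_nth:
  assumes "n \<ge> 1" "m \<ge> 1"
  shows "fps_nth (lhs_term n m) t
       = (\<Sum>(k, l) | 2 * m * n + k * (2 * n - 1) + l * (2 * m - 1) = t. (- 1) ^ k)"
proof -
  define x y s where "x = 2 * n - 1" and "y = 2 * m - 1" and "s = 2 * m * n"
  have xy: "x > 0" "y > 0" using assms by (simp_all add: x_def y_def)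
  have "lhs_term n m = fps_X ^ s * (1 * inverse ((1 + fps_X ^ x) * (1 - fps_X ^ y)))"
    using fps_X_power_divide[of "(1 + fps_X ^ x) * (1 - fps_X ^ y)" 1 s] xy
    by (simp add: x_def y_def s_def)
  also have "\<dots> = fps_X ^ s * (inverse (1 + fps_X ^ x) * inverse (1 - fps_X ^ y))"
    by (simp add: fps_inverse_mult)
  finally have eq: "lhs_term n m = fps_X ^ s * (inverse (1 + fps_X ^ x) * inverse (1 - fps_X ^ y))" .
  show ?thesis
  proof (cases "t < s")
    case True
    then have "{(k, l). s + k * x + l * y = t} = {}" by auto
    then show ?thesis unfolding eq unfolding x_def[symmetric] y_def[symmetric] s_def[symmetric]
      using True by (simp add: fps_X_power_mult_nth)
  next
    case False
    have "fps_nth (lhs_term n m) t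
        = (\<Sum>i=0..t - s. (if x dvd i then (- 1) ^ (i div x) else 0) * (if y dvd t - s - i then 1 else 0))"
      unfolding eq fps_X_power_mult_nth using False xy
      by (simp add: fps_mult_nth inverse_one_plus_X_power_nth inverse_one_minus_X_power_nth)
    also have "\<dots> = (\<Sum>i | i \<le> t - s \<and> x dvd i \<and> y dvd t - s - i. (- 1) ^ (i div x))"
      by (rule sum.mono_neutral_cong_right) auto
    also have "\<dots> = (\<Sum>(k, l) | s + k * x + l * y = t. (- 1) ^ k)"
      by (rule sum.reindex_bij_witness[where i = "\<lambda>(k, l). k * x"
            and j = "\<lambda>i. (i div x, (t - s - i) div y)"])
        (use xy False in auto)
    finally show ?thesis by (simp add: x_def y_def s_def)
  qed
qed

text \<open>
  The term with index \<open>i\<close> is divisible by \<open>q\<^sup>i\<close>, so the terms beyond \<open>t\<close> do not reach the coefficient of \<open>q\<^sup>t\<close>.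
\<close>

lemma infsum_nth_by_order:
  fixes f :: "nat \<Rightarrow> complex fps"
  assumes "\<And>i k. i \<ge> 1 \<Longrightarrow> k < i \<Longrightarrow> fps_nth (f i) k = 0"
  shows "fps_nth (infsum f {1..}) t = (\<Sum>i=1..t. fps_nth (f i) t)"
proof -
  have "fps_nth (infsum f {1..}) t = (\<Sum>i | i \<in> {1..} \<and> fps_nth (f i) t \<noteq> 0. fps_nth (f i) t)"
    by (intro fps_summable_locally_finite finite_coeffs_by_order) (use assms in auto)
  also have "\<dots> = (\<Sum>i=1..t. fps_nth (f i) t)"
    by (rule sum.mono_neutral_left) (use assms in \<open>auto simp: not_less[symmetric]\<close>)
  finally show ?thesis .
qed

lemma rhs_nth:
  "fps_nth (infsum rhs_term {1..}) t
     = (\<Sum>n=1..t. of_nat (n - 1) * (\<Sum>k | n + k * (2 * n - 1) = t. (- 1) ^ k))"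
proof -
  have "fps_nth (infsum rhs_term {1..}) t = (\<Sum>n=1..t. fps_nth (rhs_term n) t)"
    by (rule infsum_nth_by_order) (rule rhs_term_nth_eq_0)
  also have "\<dots> = (\<Sum>n=1..t. of_nat (n - 1) * (\<Sum>k | n + k * (2 * n - 1) = t. (- 1) ^ k))"
    by (intro sum.cong refl rhs_term_nth) simp
  finally show ?thesis .
qed

lemma lhs_nth:
  "fps_nth (\<Sum>\<^sub>\<infinity>n\<in>{1..}. infsum (lhs_term n) {1..}) t
     = (\<Sum>n=1..t. \<Sum>m=1..t. \<Sum>(k, l) | 2 * m * n + k * (2 * n - 1) + l * (2 * m - 1) = t. (- 1) ^ k)"
proof -
  have zero: "fps_nth (lhs_term n m) j = 0" if "n \<ge> 1" "m \<ge> 1" "j < m \<or> j < n" for n m j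
  proof -
    have "m * 1 \<le> 2 * m * n" "1 * n \<le> 2 * m * n"
      using that by (intro mult_le_mono; simp)+
    then show ?thesis using that by (intro lhs_term_nth_eq_0) linarith+
  qed
  have inner: "fps_nth (infsum (lhs_term n) {1..}) j = (\<Sum>m=1..j. fps_nth (lhs_term n m) j)"
    if "n \<ge> 1" for n j
    by (rule infsum_nth_by_order) (use zero that in auto)
  have "fps_nth (\<Sum>\<^sub>\<infinity>n\<in>{1..}. infsum (lhs_term n) {1..}) t
      = (\<Sum>n=1..t. fps_nth (infsum (lhs_term n) {1..}) t)"
  proof (rule infsum_nth_by_order)
    fix n k :: nat assume "n \<ge> 1" "k < n"
    then show "fps_nth (infsum (lhs_term n) {1..}) k = 0"
      by (subst inner) (auto intro!: sum.neutral zero simp del: One_nat_def)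
  qed
  also have "\<dots> = (\<Sum>n=1..t. \<Sum>m=1..t. fps_nth (lhs_term n m) t)"
    by (intro sum.cong refl inner) simp
  also have "\<dots> = (\<Sum>n=1..t. \<Sum>m=1..t.
      \<Sum>(k, l) | 2 * m * n + k * (2 * n - 1) + l * (2 * m - 1) = t. (- 1) ^ k)"
    by (intro sum.cong refl lhs_term_nth) simp_all
  finally show ?thesis .
qed

section \<open>A telescoping sum over quadruples\<close>

text \<open>
  The element \<open>(a, b, c, d)\<close> stands for the pair of vectors \<open>(a, b)\<close> and \<open>(c, -d)\<close>, which span a
  lattice of index \<open>ad + bc\<close>.
\<close>

definition quads :: "nat \<Rightarrow> (nat \<times> nat \<times> nat \<times> nat) set" where
  "quads N = {(a, b, c, d). 0 < a \<and> 0 < b \<and> 0 < c \<and> 0 < d \<and> a * d + b * c = N}"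

lemma finite_quads: "finite (quads N)"
proof (rule finite_subset)
  show "quads N \<subseteq> {..N} \<times> {..N} \<times> {..N} \<times> {..N}"
  proof
    fix q assume "q \<in> quads N"
    then obtain a b c d where q: "q = (a, b, c, d)" and pos: "0 < a" "0 < b" "0 < c" "0 < d"
      and N: "a * d + b * c = N" by (auto simp: quads_def)
    have "a * 1 \<le> a * d" "1 * d \<le> a * d" "b * 1 \<le> b * c" "1 * c \<le> b * c"
      using pos by (intro mult_le_mono; simp)+
    then have "a \<le> N" "b \<le> N" "c \<le> N" "d \<le> N" using N by linarith+
    then show "q \<in> {..N} \<times> {..N} \<times> {..N} \<times> {..N}" unfolding q by simp
  qed
qed simp

lemma mult_add_diff_cancel:
  fixes a x y z :: nat
  assumes "x < y"
  shows "a * x + (a * y + z - a * x) = a * y + z"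
    and "x * a + (z + a * y - x * a) = z + a * y"
  using assms by (simp_all add: trans_le_add1 trans_le_add2 mult.commute[of x a])

text \<open>
  The two branches of the step have disjoint images, \<open>a > c\<close> and \<open>a < c\<close>, and together they reach
  every quadruple with \<open>a \<noteq> c\<close>. The increments therefore sum to the total of \<open>g\<close> over \<open>a \<noteq> c\<close> minus
  its total over \<open>b \<noteq> d\<close>.
\<close>

lemma sum_quads_step:
  fixes g :: "nat \<times> nat \<times> nat \<times> nat \<Rightarrow> 'a :: ab_group_add"
  shows "(\<Sum>(a, b, c, d) | (a, b, c, d) \<in> quads N \<and> d < b. g (a + c, b - d, c, d) - g (a, b, c, d))
       + (\<Sum>(a, b, c, d) | (a, b, c, d) \<in> quads N \<and> b < d. g (a, b, a + c, d - b) - g (a, b, c, d))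
       = (\<Sum>(a, b, c, d) | (a, b, c, d) \<in> quads N \<and> b = d. g (a, b, c, d))
       - (\<Sum>(a, b, c, d) | (a, b, c, d) \<in> quads N \<and> a = c. g (a, b, c, d))"
proof -
  have fin: "finite {(a, b, c, d). (a, b, c, d) \<in> quads N \<and> P a b c d}" for P
    by (rule finite_subset[OF _ finite_quads[of N]]) auto
  define S where "S P = (\<Sum>(a, b, c, d) | (a, b, c, d) \<in> quads N \<and> P a b c d. g (a, b, c, d))" for P
  have split: "S (\<lambda>_ _ _ _. True) = S P1 + S P2 + S P3"
    if "\<And>a b c d. (P1 a b c d \<and> \<not> P2 a b c d \<and> \<not> P3 a b c d) \<or>
          (\<not> P1 a b c d \<and> P2 a b c d \<and> \<not> P3 a b c d) \<or>
          (\<not> P1 a b c d \<and> \<not> P2 a b c d \<and> P3 a b c d)" for P1 P2 P3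
  proof -
    have "S (\<lambda>_ _ _ _. True) = (\<Sum>(a, b, c, d)\<in>{(a, b, c, d). (a, b, c, d) \<in> quads N \<and> P1 a b c d} \<union>
       {(a, b, c, d). (a, b, c, d) \<in> quads N \<and> P2 a b c d} \<union>
       {(a, b, c, d). (a, b, c, d) \<in> quads N \<and> P3 a b c d}. g (a, b, c, d))"
      unfolding S_def by (rule sum.cong) (use that in auto)
    also have "\<dots> = S P1 + S P2 + S P3"
      unfolding S_def
      by (subst sum.union_disjoint, (intro finite_UnI fin)+, use that in blast)+ (rule refl)
    finally show ?thesis .
  qed
  have "(\<Sum>(a, b, c, d) | (a, b, c, d) \<in> quads N \<and> d < b. g (a + c, b - d, c, d)) = S (\<lambda>a b c d. c < a)"
    unfolding S_def
    by (rule sum.reindex_bij_witness[where j = "\<lambda>(a, b, c, d). (a + c, b - d, c, d)"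
          and i = "\<lambda>(a, b, c, d). (a - c, b + d, c, d)"])
      (auto simp: quads_def algebra_simps diff_mult_distrib mult_add_diff_cancel)
  moreover have "(\<Sum>(a, b, c, d) | (a, b, c, d) \<in> quads N \<and> b < d. g (a, b, a + c, d - b))
      = S (\<lambda>a b c d. a < c)"
    unfolding S_def
    by (rule sum.reindex_bij_witness[where j = "\<lambda>(a, b, c, d). (a, b, a + c, d - b)"
          and i = "\<lambda>(a, b, c, d). (a, b, c - a, d + b)"])
      (auto simp: quads_def algebra_simps diff_mult_distrib mult_add_diff_cancel)
  moreover have "S (\<lambda>_ _ _ _. True) = S (\<lambda>a b c d. c < a) + S (\<lambda>a b c d. a < c) + S (\<lambda>a b c d. a = c)"
    by (rule split) auto
  moreover have "S (\<lambda>_ _ _ _. True) = S (\<lambda>a b c d. d < b) + S (\<lambda>a b c d. b < d) + S (\<lambda>a b c d. b = d)"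
    by (rule split) auto
  ultimately show ?thesis
    by (simp add: S_def case_prod_unfold sum_subtractf algebra_simps)
qed

section \<open>The weight and its increments\<close>

definition chi :: "nat \<Rightarrow> int" where
  "chi n = (if n mod 4 = 1 then 1 else if n mod 4 = 3 then - 1 else 0)"

lemma chi_odd: "chi (2 * k + 1) = (- 1) ^ k"
proof (cases "even k")
  case True
  then obtain j where "k = 2 * j" by blast
  then show ?thesis by (simp add: chi_def mod_Suc)
next
  case False
  then obtain j where "k = 2 * j + 1" by (auto elim: oddE)
  then have "2 * k + 1 = 3 + 4 * j" by simp
  then have "(2 * k + 1) mod 4 = 3" by (simp only: mod_mult_self2) simp
  then show ?thesis using False by (simp add: chi_def)
qed

lemma chi_eq_minus_if_mult_mod_4:
  assumes "(x * y) mod 4 = 3"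
  shows "chi x = - chi y"
proof -
  have "((x mod 4) * (y mod 4)) mod 4 = 3" using assms by (simp add: mod_mult_eq)
  moreover have "x mod 4 \<in> {0, 1, 2, 3}" "y mod 4 \<in> {0, 1, 2, 3}" by auto
  ultimately show ?thesis unfolding chi_def by auto
qed

lemma chi_eq_minus_if_even_mult:
  assumes "(e * f + x * y) mod 4 = 3" "even e" "even f"
  shows "chi x = - chi y"
proof (rule chi_eq_minus_if_mult_mod_4)
  from assms obtain e' f' where "e = 2 * e'" "f = 2 * f'" by (auto elim!: evenE)
  then have "e * f + x * y = x * y + 4 * (e' * f')" by simp
  then show "(x * y) mod 4 = 3" using assms(1) by (metis mod_mult_self2)
qed

text \<open>
  The restriction to even \<open>a\<close> makes the boundary \<open>a = c\<close> vanish for odd \<open>N\<close>, and \<open>\<chi>(b)\<close> gives the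
  divisor sum on the boundary \<open>b = d\<close>. With \<open>\<chi>(b)\<close> alone, the increments would contain, besides the
  wanted summand and a part that cancels by symmetry, the difference of two sums of equal value, over \<open>b > d\<close> with \<open>d\<close> even, whose equality is itself proved
  by telescoping. Doubling the weight for odd \<open>d\<close> combines both arguments into one, as the
  increments with \<open>d\<close> even then cancel pointwise.
\<close>

definition weight :: "nat \<times> nat \<times> nat \<times> nat \<Rightarrow> int" where
  "weight = (\<lambda>(a, b, c, d). if even a then (if odd d then 2 else 1) * chi b else 0)"

text \<open>
  The last two weights are the increment at the quadruple \<open>(d, c, b - d, a + c)\<close>, which lies in
  the region where the second branch of the step applies. It is the image of \<open>(a, b, c, d)\<close>
  under a quarter turn of the plane, with signs normalised: \<open>(c, -d)\<close> turns into \<open>(d, c)\<close>, and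
  \<open>(a + c, b - d)\<close> into the negative of \<open>(b - d, -(a + c))\<close>. For odd \<open>d\<close> this
  increment is zero, and the two terms on the right are what the first branch gives. For even \<open>d\<close>
  everything must cancel, and it does because \<open>\<chi>(c)\<close> is opposite to \<open>\<chi>(b - d)\<close> or to \<open>\<chi>(b)\<close>,
  according to the parity of \<open>a\<close>.
\<close>

lemma weight_increments:
  assumes "(a, b, c, d) \<in> quads N" "d < b" "N mod 4 = 3"
  shows "weight (a + c, b - d, c, d) - weight (a, b, c, d)
           + (weight (d, c, b, a) - weight (d, c, b - d, a + c))
       = 2 * (if odd a \<and> even b \<and> odd c \<and> odd d then chi (b - d) else 0)
           - 2 * (if even a \<and> odd d then chi b else 0)"
proof -
  obtain u where b: "b = u + d" using assms(2) by (metis add.commute less_imp_add_positive)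
  have N: "a * d + b * c = N" using assms(1) by (simp add: quads_def)
  have "odd N" using assms(3) by presburger
  then have par: "odd (a * d + b * c)" using N by simp
  show ?thesis
  proof (cases "odd d")
    case True
    then show ?thesis using par by (auto simp: weight_def)
  next
    case False
    then have bc: "odd b" "odd c" using par by auto
    show ?thesis
    proof (cases "odd a")
      case True
      have "((a + c) * d + u * c) mod 4 = 3"
        using N assms(3) by (simp add: b algebra_simps)
      then have "chi u = - chi c" by (rule chi_eq_minus_if_even_mult) (use True bc False in auto)
      then show ?thesis using True False bc by (simp add: weight_def b)
    next
      case a: False
      have "chi b = - chi c"
        by (rule chi_eq_minus_if_even_mult[of a d]) (use N assms(3) a False in auto)
      then show ?thesis using a False bc by (simp add: weight_def)
    qed
  qed
qed

text \<open>
  Exchanging the two coordinates of the plane maps the vectors \<open>(a, b)\<close> and \<open>(a + c, b - d)\<close> to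
  \<open>(b, a)\<close> and \<open>(b - d, a + c)\<close>, which is an involution on the quadruples with \<open>b > d\<close>. For even \<open>a\<close> and
  \<open>b - d\<close> the identity \<open>(a + c) b = N + a (b - d)\<close> shows that it changes the sign of \<open>\<chi>(b)\<close>.
\<close>

lemma sum_chi_antisymmetric:
  assumes "N mod 4 = 3"
  shows "(\<Sum>(a, b, c, d) | (a, b, c, d) \<in> quads N \<and> d < b. if even a \<and> odd d then chi b else 0) = 0"
    (is "?S = 0")
proof -
  have "odd N" using assms by presburger
  have "?S = (\<Sum>(a, b, c, d) | (a, b, c, d) \<in> quads N \<and> d < b. - (if even a \<and> odd d then chi b else 0))"
  proof (rule sum.reindex_bij_witness[where i = "\<lambda>(a, b, c, d). (b - d, a + c, d, c)"
        and j = "\<lambda>(a, b, c, d). (b - d, a + c, d, c)"], goal_cases)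
    case (5 q)
    then obtain a b c d where q: "q = (a, b, c, d)" and Q: "(a, b, c, d) \<in> quads N" "d < b" by auto
    obtain u where b: "b = u + d" using Q(2) by (metis add.commute less_imp_add_positive)
    have N: "a * d + b * c = N" using Q(1) by (simp add: quads_def)
    then have par: "odd (a * d + b * c)" using \<open>odd N\<close> by simp
    have "even u \<and> odd c \<longleftrightarrow> even a \<and> odd d"
      using par unfolding b by auto
    moreover have "chi (a + c) = - chi b" if "even a" "even u"
    proof -
      have "(a + c) * b = N + a * u" using N by (simp add: b algebra_simps)
      moreover have "4 dvd a * u" using mult_dvd_mono[of 2 a 2 u] that by simp
      ultimately have "((a + c) * b) mod 4 = 3" using assms by (auto elim!: dvdE)
      then show ?thesis by (rule chi_eq_minus_if_mult_mod_4)
    qed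
    ultimately show ?case by (auto simp: q b)
  qed (auto simp: quads_def algebra_simps diff_mult_distrib)
  also have "\<dots> = - ?S" by (simp add: case_prod_unfold sum_negf)
  finally show ?thesis by simp
qed

lemma sum_chi_quads:
  assumes N: "N mod 4 = 3"
  shows "(\<Sum>(a, b, c, d) | (a, b, c, d) \<in> quads N \<and> d < b.
            if odd a \<and> even b \<and> odd c \<and> odd d then chi (b - d) else 0)
       = (\<Sum>(a, b, c, d) | (a, b, c, d) \<in> quads N \<and> b = d. if even a then chi b else 0)"
    (is "?L = ?R")
proof -
  have "odd N" using assms by presburger
  let ?P = "{(a, b, c, d). (a, b, c, d) \<in> quads N \<and> d < b}"
  \<comment> \<open>The quarter turn moves the second branch of the step to the region of the first.\<close>
  have "(\<Sum>(a, b, c, d) | (a, b, c, d) \<in> quads N \<and> b < d. weight (a, b, a + c, d - b) - weight (a, b, c, d))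
      = (\<Sum>(a, b, c, d)\<in>?P. weight (d, c, b, a) - weight (d, c, b - d, a + c))"
    by (rule sum.reindex_bij_witness[where i = "\<lambda>(a, b, c, d). (d, c, b - d, a + c)"
          and j = "\<lambda>(a, b, c, d). (d - b, a + c, b, a)"])
      (auto simp: quads_def algebra_simps diff_mult_distrib mult_add_diff_cancel)
  with sum_quads_step[of weight N]
  have "(\<Sum>(a, b, c, d)\<in>?P. weight (a + c, b - d, c, d) - weight (a, b, c, d)
           + (weight (d, c, b, a) - weight (d, c, b - d, a + c)))
      = (\<Sum>(a, b, c, d) | (a, b, c, d) \<in> quads N \<and> b = d. weight (a, b, c, d))
       - (\<Sum>(a, b, c, d) | (a, b, c, d) \<in> quads N \<and> a = c. weight (a, b, c, d))"
    by (simp add: case_prod_unfold sum.distrib)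
  also have "(\<Sum>(a, b, c, d)\<in>?P. weight (a + c, b - d, c, d) - weight (a, b, c, d)
           + (weight (d, c, b, a) - weight (d, c, b - d, a + c)))
      = (\<Sum>(a, b, c, d)\<in>?P. 2 * (if odd a \<and> even b \<and> odd c \<and> odd d then chi (b - d) else 0)
           - 2 * (if even a \<and> odd d then chi b else 0))"
    by (rule sum.cong) (auto simp only: weight_increments[OF _ _ N] split: prod.splits)
  also have "\<dots> = 2 * ?L"
    using sum_chi_antisymmetric[OF N]
    by (simp add: case_prod_unfold sum_subtractf flip: sum_distrib_left)
  also have "(\<Sum>(a, b, c, d) | (a, b, c, d) \<in> quads N \<and> a = c. weight (a, b, c, d)) = 0"
    using \<open>odd N\<close> by (intro sum.neutral) (auto simp: quads_def weight_def)
  also have "(\<Sum>(a, b, c, d) | (a, b, c, d) \<in> quads N \<and> b = d. weight (a, b, c, d)) = 2 * ?R"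
    unfolding sum_distrib_left
    using \<open>odd N\<close> by (intro sum.cong) (auto simp: quads_def weight_def)
  finally show ?thesis by simp
qed

section \<open>The coefficients as character sums\<close>

text \<open>
  With \<open>x = 2n - 1\<close>, \<open>y = 2m - 1\<close>, \<open>u = 2k + 1\<close> and \<open>v = 2l + 1\<close>, doubling the exponent equation
  \<open>2mn + kx + ly = 2r\<close> gives \<open>xy + xu + yv = 4r - 1\<close>, that is \<open>vy + (y + u) x = 4r - 1\<close>.
\<close>

lemma lhs_nth_eq_sum_chi:
  assumes "r > 0"
  shows "fps_nth (\<Sum>\<^sub>\<infinity>n\<in>{1..}. infsum (lhs_term n) {1..}) (2 * r)
    = of_int (\<Sum>(a, b, c, d) | (a, b, c, d) \<in> quads (4 * r - 1) \<and> d < b.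
            if odd a \<and> even b \<and> odd c \<and> odd d then chi (b - d) else 0)"
proof -
  define K where "K n m = {(k, l). 2 * m * n + k * (2 * n - 1) + l * (2 * m - 1) = 2 * r}" for n m :: nat
  have K_fin: "finite (K n m)" if "n \<in> {1..2*r}" "m \<in> {1..2*r}" for n m
  proof (rule finite_subset)
    show "K n m \<subseteq> {..2*r} \<times> {..2*r}"
    proof
      fix p assume "p \<in> K n m"
      then obtain k l where p: "p = (k, l)" "2 * m * n + k * (2 * n - 1) + l * (2 * m - 1) = 2 * r"
        by (auto simp: K_def)
      have "k * 1 \<le> k * (2 * n - 1)" "l * 1 \<le> l * (2 * m - 1)"
        using that by (intro mult_le_mono; auto)+
      then have "k \<le> 2 * r" "l \<le> 2 * r" using p(2) by linarith+
      then show "p \<in> {..2*r} \<times> {..2*r}" using p(1) by simp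
    qed
  qed simp
  define T where "T = (SIGMA n:{1..2*r}. SIGMA m:{1..2*r}. K n m)"
  have T: "(n, m, k, l) \<in> T \<longleftrightarrow> n \<ge> 1 \<and> m \<ge> 1 \<and>
    (2 * l + 1) * (2 * m - 1) + (2 * m - 1 + (2 * k + 1)) * (2 * n - 1) = 4 * r - 1" (is "_ \<longleftrightarrow> ?B") for n m k l
  proof (cases "n \<ge> 1 \<and> m \<ge> 1")
    case True
    then obtain n' m' where nm: "n = Suc n'" "m = Suc m'" by (metis Suc_le_D One_nat_def)
    have "n \<le> 2 * m * n" "m \<le> 2 * m * n" using True by auto
    then have "n \<le> 2 * r \<and> m \<le> 2 * r"
      if "2 * m * n + k * (2 * n - 1) + l * (2 * m - 1) = 2 * r" using that by linarith
    then have "(n, m, k, l) \<in> T \<longleftrightarrow> 2 * m * n + k * (2 * n - 1) + l * (2 * m - 1) = 2 * r"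
      using True by (auto simp: T_def K_def)
    moreover have "(2 * l + 1) * (2 * m - 1) + (2 * m - 1 + (2 * k + 1)) * (2 * n - 1) + 1
        = 2 * (2 * m * n + k * (2 * n - 1) + l * (2 * m - 1))"
      by (simp add: nm algebra_simps)
    ultimately have "(n, m, k, l) \<in> T \<longleftrightarrow>
        (2 * l + 1) * (2 * m - 1) + (2 * m - 1 + (2 * k + 1)) * (2 * n - 1) + 1 = 2 * (2 * r)"
      by (simp only: mult_cancel_left) simp
    also have "\<dots> \<longleftrightarrow> ?B" using True assms by linarith
    finally show ?thesis .
  qed (auto simp: T_def)
  have "fps_nth (\<Sum>\<^sub>\<infinity>n\<in>{1..}. infsum (lhs_term n) {1..}) (2 * r)
      = (\<Sum>n=1..2*r. \<Sum>m=1..2*r. \<Sum>(k, l)\<in>K n m. (- 1) ^ k)"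
    unfolding lhs_nth K_def ..
  also have "\<dots> = (\<Sum>n=1..2*r. \<Sum>(m, k, l)\<in>(SIGMA m:{1..2*r}. K n m). (- 1) ^ k)"
    by (intro sum.cong refl sum.Sigma ballI K_fin) auto
  also have "\<dots> = (\<Sum>(n, m, k, l)\<in>T. (- 1) ^ k)"
    unfolding T_def by (intro sum.Sigma ballI finite_SigmaI K_fin) auto
  also have "\<dots> = of_int (\<Sum>(n, m, k, l)\<in>T. chi (2 * k + 1))"
    by (simp add: chi_odd[simplified] case_prod_unfold)
  also have "(\<Sum>(n, m, k, l)\<in>T. chi (2 * k + 1))
      = (\<Sum>(a, b, c, d) | (a, b, c, d) \<in> quads (4 * r - 1) \<and> d < b \<and>
            odd a \<and> even b \<and> odd c \<and> odd d. chi (b - d))"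
  proof -
    define j :: "nat \<times> nat \<times> nat \<times> nat \<Rightarrow> nat \<times> nat \<times> nat \<times> nat" where
      "j = (\<lambda>(n, m, k, l). (2 * l + 1, 2 * m - 1 + (2 * k + 1), 2 * n - 1, 2 * m - 1))"
    define S where "S = {(a, b, c, d). (a, b, c, d) \<in> quads (4 * r - 1) \<and> d < b \<and>
            odd a \<and> even b \<and> odd c \<and> odd d}"
    have "j p \<in> S" if "p \<in> T" for p
    proof (cases p)
      case (fields n m k l)
      from that[unfolded fields T] have "n \<ge> 1" "m \<ge> 1"
        and eq: "(2 * l + 1) * (2 * m - 1) + (2 * m - 1 + (2 * k + 1)) * (2 * n - 1) = 4 * r - 1"
        by blast+
      then show ?thesis
        unfolding S_def fields j_def quads_def prod.case mem_Collect_eq by (intro conjI eq) auto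
    qed
    moreover have "q \<in> j ` T" if "q \<in> S" for q
    proof -
      from that[unfolded S_def] obtain a b c d where q: "q = (a, b, c, d)" and Q: "(a, b, c, d) \<in> quads (4 * r - 1)"
        and "d < b" "odd a" "even b" "odd c" "odd d" by blast
      define n m k l where "n = (c + 1) div 2" "m = (d + 1) div 2" "k = (b - d) div 2" "l = a div 2"
      have "odd (b - d)" using \<open>d < b\<close> \<open>even b\<close> \<open>odd d\<close> by simp
      then have "2 * k + 1 = b - d" unfolding n_m_k_l_def by (rule odd_two_times_div_two_succ)
      then have "a = 2 * l + 1" "c = 2 * n - 1" "d = 2 * m - 1" "b = 2 * m - 1 + (2 * k + 1)" "n \<ge> 1" "m \<ge> 1"
        using \<open>d < b\<close> \<open>odd a\<close> \<open>odd c\<close> \<open>odd d\<close> unfolding n_m_k_l_def by (auto elim!: oddE)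
      then have "(n, m, k, l) \<in> T" "q = j (n, m, k, l)"
        using Q by (simp_all add: T quads_def j_def q)
      then show ?thesis by blast
    qed
    ultimately have "S = j ` T" by blast
    moreover have "inj_on j T"
    proof (rule inj_onI)
      fix p q assume *: "p \<in> T" "q \<in> T" "j p = j q"
      obtain n m k l n' m' k' l' where pq: "p = (n, m, k, l)" "q = (n', m', k', l')"
        by (metis prod_cases4)
      from *(1,2) have "n \<ge> 1" "m \<ge> 1" "n' \<ge> 1" "m' \<ge> 1" unfolding pq T by blast+
      then show "p = q" using *(3) by (simp add: pq j_def) presburger
    qed
    ultimately show ?thesis
      unfolding S_def[symmetric] by (simp only: sum.reindex) (auto simp: j_def intro!: sum.cong)
  qed
  also have "\<dots> = (\<Sum>(a, b, c, d) | (a, b, c, d) \<in> quads (4 * r - 1) \<and> d < b.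
            if odd a \<and> even b \<and> odd c \<and> odd d then chi (b - d) else 0)"
    by (rule sum.mono_neutral_cong_left) (auto intro: finite_subset[OF _ finite_quads] split: if_splits)
  finally show ?thesis .
qed

text \<open>
  Doubling the exponent equation \<open>n + k (2n - 1) = 2r\<close> gives \<open>(2k + 1)(2n - 1) = 4r - 1\<close>, and the
  factor \<open>n - 1\<close> counts the ways to write \<open>2n - 1 = a + c\<close> with \<open>a\<close> even and both parts positive.
\<close>

lemma rhs_nth_eq_sum_chi:
  assumes "r > 0"
  shows "fps_nth (infsum rhs_term {1..}) (2 * r)
    = of_int (\<Sum>(a, b, c, d) | (a, b, c, d) \<in> quads (4 * r - 1) \<and> b = d. if even a then chi b else 0)"
proof -
  define K where "K n = {k. n + k * (2 * n - 1) = 2 * r}" for n :: nat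
  have K_fin: "finite (K n)" if "n \<in> {1..2*r}" for n
  proof (rule finite_subset)
    show "K n \<subseteq> {..2*r}"
    proof
      fix k assume "k \<in> K n"
      moreover have "k * 1 \<le> k * (2 * n - 1)"
        using that by (intro mult_le_mono) auto
      ultimately have "k \<le> 2 * r" unfolding K_def mem_Collect_eq by linarith
      then show "k \<in> {..2*r}" by simp
    qed
  qed simp
  define T where "T = (SIGMA n:{1..2*r}. {1..<n} \<times> K n)"
  have T: "(n, j, k) \<in> T \<longleftrightarrow> 1 \<le> j \<and> j < n \<and> (2 * k + 1) * (2 * n - 1) = 4 * r - 1" (is "_ \<longleftrightarrow> ?B") for n j k
  proof (cases "n \<ge> 1")
    case True
    then obtain n' where n: "n = Suc n'" by (metis Suc_le_D One_nat_def)
    have "(n, j, k) \<in> T \<longleftrightarrow> 1 \<le> j \<and> j < n \<and> n + k * (2 * n - 1) = 2 * r"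
      using True by (auto simp: T_def K_def)
    moreover have "(2 * k + 1) * (2 * n - 1) + 1 = 2 * (n + k * (2 * n - 1))"
      by (simp add: n algebra_simps)
    ultimately have "(n, j, k) \<in> T \<longleftrightarrow> 1 \<le> j \<and> j < n \<and> (2 * k + 1) * (2 * n - 1) + 1 = 2 * (2 * r)"
      by (simp only: mult_cancel_left) simp
    also have "\<dots> \<longleftrightarrow> ?B" using assms by linarith
    finally show ?thesis .
  qed (auto simp: T_def)
  have "fps_nth (infsum rhs_term {1..}) (2 * r) = (\<Sum>n=1..2*r. \<Sum>j\<in>{1..<n}. \<Sum>k\<in>K n. (- 1) ^ k)"
    unfolding rhs_nth K_def by simp
  also have "\<dots> = (\<Sum>n=1..2*r. \<Sum>(j, k)\<in>{1..<n} \<times> K n. (- 1) ^ k)"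
    by (simp only: sum.cartesian_product)
  also have "\<dots> = (\<Sum>(n, j, k)\<in>T. (- 1) ^ k)"
    unfolding T_def by (intro sum.Sigma ballI finite_SigmaI K_fin) auto
  also have "\<dots> = of_int (\<Sum>(n, j, k)\<in>T. chi (2 * k + 1))"
    by (simp add: chi_odd[simplified] case_prod_unfold)
  also have "(\<Sum>(n, j, k)\<in>T. chi (2 * k + 1))
      = (\<Sum>(a, b, c, d) | (a, b, c, d) \<in> quads (4 * r - 1) \<and> b = d \<and> even a. chi b)"
  proof -
    define f :: "nat \<times> nat \<times> nat \<Rightarrow> nat \<times> nat \<times> nat \<times> nat" where
      "f = (\<lambda>(n, j, k). (2 * j, 2 * k + 1, 2 * n - 1 - 2 * j, 2 * k + 1))"
    define S where "S = {(a, b, c, d). (a, b, c, d) \<in> quads (4 * r - 1) \<and> b = d \<and> even a}"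
    have "f p \<in> S" if "p \<in> T" for p
    proof (cases p)
      case (fields n j k)
      from that[unfolded fields T]
      have *: "1 \<le> j" "j < n" "(2 * k + 1) * (2 * n - 1) = 4 * r - 1" by blast+
      then have "2 * n - 1 = 2 * j + (2 * n - 1 - 2 * j)" by simp
      then have "2 * j * (2 * k + 1) + (2 * k + 1) * (2 * n - 1 - 2 * j) = 4 * r - 1"
        using *(3) by (metis add_mult_distrib2 mult.commute)
      then show ?thesis using * unfolding S_def fields f_def quads_def by simp
    qed
    moreover have "q \<in> f ` T" if "q \<in> S" for q
    proof -
      from that[unfolded S_def] obtain a b c where q: "q = (a, b, c, b)" and Q: "(a, b, c, b) \<in> quads (4 * r - 1)"
        and "even a" by blast
      have pos: "a > 0" "c > 0" and eq: "b * (a + c) = 4 * r - 1"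
        using Q by (auto simp: quads_def algebra_simps)
      have "odd (4 * r - 1)" using assms by presburger
      then have "odd (b * (a + c))" unfolding eq .
      then have odd: "odd b" "odd (a + c)" by auto
      define n j k where "n = (a + c + 1) div 2" "j = a div 2" "k = b div 2"
      have "a = 2 * j" "b = 2 * k + 1" "a + c = 2 * n - 1"
        using \<open>even a\<close> odd unfolding n_j_k_def by presburger+
      then have "(n, j, k) \<in> T" "q = f (n, j, k)"
        using eq pos by (auto simp: T f_def q)
      then show ?thesis by blast
    qed
    ultimately have "S = f ` T" by blast
    moreover have "inj_on f T"
    proof (rule inj_onI)
      fix p q assume *: "p \<in> T" "q \<in> T" "f p = f q"
      obtain n j k n' j' k' where pq: "p = (n, j, k)" "q = (n', j', k')"
        by (metis prod_cases3)
      from *(1,2) have "j < n" "j' < n'" unfolding pq T by blast+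
      then show "p = q" using *(3) by (simp add: pq f_def) presburger
    qed
    ultimately show ?thesis
      unfolding S_def[symmetric] by (simp only: sum.reindex) (auto simp: f_def intro!: sum.cong)
  qed
  also have "\<dots> = (\<Sum>(a, b, c, d) | (a, b, c, d) \<in> quads (4 * r - 1) \<and> b = d. if even a then chi b else 0)"
    by (rule sum.mono_neutral_cong_left) (auto intro: finite_subset[OF _ finite_quads] split: if_splits)
  finally show ?thesis .
qed

theorem theorem1p3:
  fixes r :: nat
  assumes "r > 0"
  shows "fps_nth (\<Sum>\<^sub>\<infinity>n\<in>{1::nat..}. \<Sum>\<^sub>\<infinity>m\<in>{1::nat..}.
           (fps_X ^ (2 * m * n) / ((1 + fps_X ^ (2 * n - 1)) * (1 - fps_X ^ (2 * m - 1))) :: complex fps)) (2 * r)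
       = fps_nth (\<Sum>\<^sub>\<infinity>n\<in>{1::nat..}.
           (of_nat (n - 1) * fps_X ^ n / (1 + fps_X ^ (2 * n - 1)) :: complex fps)) (2 * r)"
proof -
  from assms obtain s where "r = Suc s" using gr0_conv_Suc by blast
  then have "4 * r - 1 = 3 + 4 * s" by simp
  then have "(4 * r - 1) mod 4 = 3" by simp
  from sum_chi_quads[OF this] show ?thesis
    using lhs_nth_eq_sum_chi[OF assms] rhs_nth_eq_sum_chi[OF assms] by simp
qed

end
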